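(* Let $f:\mathbb{R}^d\to\mathbb{R}$ be a locally smooth convex function having a minimizer $x_\star$, and let $f_\star=f(x_\star)$. Let $\gamma\in(0,1]$, $A_k=\gamma(k+1)+2$ and $B_k=\gamma(k+1)$ for $k\ge0$, and $r=\left(\frac{A_0}{B_0}+\frac{B_1+1}{A_0}\right)^{-1}=\frac{\gamma(\gamma+2)}{3\gamma^2+5\gamma+4}\le 1$. Let $x_0\ne\tilde x_0$ be such that $L_0=\|\nabla f(x_0)-\nabla f(\tilde x_0)\|/\|x_0-\tilde x_0\|>0$, and let $\{x_k\}_{k\ge0}$ be generated by AdaGD (defined in the context) from $x_0$ with $s_0=rA_0\frac1{L_0}$. Let $\bar R=\|x_0-x_\star\|^2+(B_0+1)s_0^2\|\nabla f(x_0)\|^2$, let $L>0$ be a smoothness parameter of $f$ on $\bar B_{3\sqrt{\bar R}}(x_\star)\cup\bar B_{3\|\tilde x_0-x_\star\|}(x_\star)$, and let $R=\bar R-\frac{s_0}{L}\|\nabla f(x_0)\|^2$. Then $$f(x_k)-f_\star\le\frac{L}{2r}\,\frac{1}{\gamma(k+1)+2}\,R=\mathcal{O}\left(\frac Lk\right)\quad(k\ge0),$$ $$\min_{i\in\{1,\dots,k\}}\|\nabla f(x_i)\|^2\le\frac{2L^2}{r}\,\frac{1}{k\,(r\gamma(k+3)+2)}\,R=\mathcal{O}\left(\frac{L^2}{k^2}\right)\quad(k\ge1).$$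
   Context: $f$ is locally smooth if it is differentiable and $\nabla f$ is Lipschitz on every compact subset of $\mathbb{R}^d$; a smoothness parameter of $f$ on a compact set $K$ is an $L_K>0$ with $\|\nabla f(x)-\nabla f(y)\|\le L_K\|x-y\|$ for all $x,y\in K$. $\bar B_\rho(c)=\{x:\|x-c\|\le\rho\}$. AdaGD with parameters $\{A_k\}_{k\ge 0},\{B_k\}_{k\ge 0}$ and $A_{-1}=0$ (by convention, not by the formula for $A_k$): given $x_0\in\mathbb{R}^d$, $s_0>0$, for $k=0,1,2,\dots$: $$x_{k+1}=x_k-s_k\nabla f(x_k),\qquad L_{k+1}=-\frac{\frac12\|\nabla f(x_{k+1})-\nabla f(x_k)\|^2}{f(x_{k+1})-f(x_k)+\langle\nabla f(x_{k+1}),x_k-x_{k+1}\rangle},$$ $$s_{k+1}=\min\left\{\frac{A_{k-1}+1}{A_k}s_k,\ \left(\frac{A_k}{B_k}+\frac{B_{k+1}+1}{A_k}\right)^{-1}\frac1{L_{k+1}}\right\}.$$ Conventions: $\frac00=0$ and $\frac a0=+\infty$ for $a>0$. *)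

theory Defs
  imports "HOL-Analysis.Analysis" "HOL-Library.Landau_Symbols"
begin

definition grad :: "('a::real_inner \<Rightarrow> real) \<Rightarrow> 'a \<Rightarrow> 'a" where
  "grad f x = (THE g. GDERIV f x :> g)"

definition locally_smooth :: "('a::real_inner \<Rightarrow> real) \<Rightarrow> bool" where
  "locally_smooth f \<longleftrightarrow>
     (\<forall>x. f differentiable (at x)) \<and>
     (\<forall>K. compact K \<longrightarrow> (\<exists>C. C-lipschitz_on K (grad f)))"

definition smoothness_parameter :: "('a::real_inner \<Rightarrow> real) \<Rightarrow> 'a set \<Rightarrow> real \<Rightarrow> bool" where
  "smoothness_parameter f K L \<longleftrightarrow>
     L > 0 \<and> (\<forall>x\<in>K. \<forall>y\<in>K. norm (grad f x - grad f y) \<le> L * norm (x - y))"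

(* Division on ereal satisfies 0 / 0 = 0 and a / 0 = \<infinity> for a > 0, which are the
   conventions of the algorithm.  For convex differentiable f the denominator below is
   nonpositive. *)
definition local_curvature :: "('a::real_inner \<Rightarrow> real) \<Rightarrow> 'a \<Rightarrow> 'a \<Rightarrow> ereal" where
  "local_curvature f x y =
     - (ereal (1/2 * (norm (grad f y - grad f x))\<^sup>2) /
        ereal (f y - f x + grad f y \<bullet> (x - y)))"

(* prev A k is A (k - 1), with the convention that the value at index -1 is 0. *)
definition prev :: "(nat \<Rightarrow> real) \<Rightarrow> nat \<Rightarrow> real" where
  "prev A k = (case k of 0 \<Rightarrow> 0 | Suc j \<Rightarrow> A j)"

(* The sequences x and s are generated by AdaGD from x 0 and s 0.  The minimum is taken in
   ereal, since 1 / L (k + 1) is infinite when L (k + 1) = 0. *)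
definition adagd ::
  "(nat \<Rightarrow> real) \<Rightarrow> (nat \<Rightarrow> real) \<Rightarrow> ('a::real_inner \<Rightarrow> real) \<Rightarrow> (nat \<Rightarrow> 'a) \<Rightarrow> (nat \<Rightarrow> real) \<Rightarrow> bool" where
  "adagd A B f x s \<longleftrightarrow>
     s 0 > 0 \<and>
     (\<forall>k. x (Suc k) = x k - s k *\<^sub>R grad f (x k) \<and>
          ereal (s (Suc k)) =
            min (ereal ((prev A k + 1) / A k * s k))
                (ereal (inverse (A k / B k + (B (Suc k) + 1) / A k))
                   * (1 / local_curvature f (x k) (x (Suc k)))))"

lemma GDERIV_grad:
  fixes f :: "'a::euclidean_space \<Rightarrow> real"
  assumes "f differentiable (at x)"
  shows "GDERIV f x :> grad f x"
proof -
  obtain F where F: "(f has_derivative F) (at x)"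
    using assms by (auto simp: differentiable_def)
  then have lin: "linear F"
    by (rule has_derivative_linear)
  have "F h = h \<bullet> adjoint F 1" for h
    using adjoint_works[OF lin, of h 1] by simp
  then have F': "F = (\<lambda>h. h \<bullet> adjoint F 1)"
    by (rule ext)
  have "GDERIV f x :> adjoint F 1"
    unfolding gderiv_def using F F' by simp
  moreover have "g = adjoint F 1" if "GDERIV f x :> g" for g
  proof -
    have "(\<lambda>h. h \<bullet> g) = F"
      using that F unfolding gderiv_def by (rule has_derivative_unique)
    then have "h \<bullet> g = h \<bullet> adjoint F 1" for h
      using F' by metis
    then show ?thesis
      by (metis vector_eq_ldot)
  qed
  ultimately show ?thesis
    unfolding grad_def by (rule theI)
qed

end

theory Submission
  imports Defs
begin

text \<open>
  Write \<open>g\<^sub>k\<close> for the gradient at \<open>x\<^sub>k\<close> and \<open>\<delta>\<^sub>k = f x\<^sub>k - f\<^sub>\<star>\<close>. Expanding \<open>\<parallel>x\<^sub>k\<^sub>+\<^sub>1 - x\<^sub>\<star>\<parallel>\<^sup>2\<close>, using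
  cocoercivity between \<open>x\<^sub>k\<close> and \<open>x\<^sub>\<star>\<close>, and adding \<open>2 s\<^sub>k A\<^sub>k\<^sub>-\<^sub>1\<close> times the identity that defines \<open>L\<^sub>k\<close>
  shows that \<open>\<parallel>x\<^sub>k\<^sub>+\<^sub>1 - x\<^sub>\<star>\<parallel>\<^sup>2 + 2 s\<^sub>k (A\<^sub>k\<^sub>-\<^sub>1 + 1) \<delta>\<^sub>k + B\<^sub>k s\<^sub>k\<^sup>2 \<parallel>g\<^sub>k\<parallel>\<^sup>2\<close> decreases: the first bound on the
  step size handles the term in \<open>\<delta>\<^sub>k\<close>, the second controls a quadratic form in \<open>(g\<^sub>k, g\<^sub>k\<^sub>+\<^sub>1)\<close>.
  The iterates therefore stay in a ball around \<open>x\<^sub>\<star>\<close>, where \<open>L\<^sub>k \<le> L\<close>, so that \<open>s\<^sub>k \<ge> r / L\<close> for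
  \<open>k \<ge> 1\<close>; this gives the rate for \<open>f\<close>. The decrease from \<open>k\<close> to \<open>k + 1\<close> is at
  least \<open>s\<^sub>k\<^sub>+\<^sub>1 / L \<parallel>g\<^sub>k\<^sub>+\<^sub>1\<parallel>\<^sup>2 + A\<^sub>k s\<^sub>k s\<^sub>k\<^sub>+\<^sub>1 \<parallel>g\<^sub>k\<parallel>\<^sup>2\<close>, and summing it gives the rate for the
  gradients, because \<open>A\<^sub>k\<close> grows linearly.
\<close>

section \<open>Gradient inequalities for convex functions\<close>

lemma has_real_derivative_along_line:
  fixes f :: "'a::euclidean_space \<Rightarrow> real"
  assumes "f differentiable (at (x + t *\<^sub>R d))"
  shows "((\<lambda>t. f (x + t *\<^sub>R d)) has_real_derivative (grad f (x + t *\<^sub>R d) \<bullet> d)) (at t)"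
proof -
  have f': "(f has_derivative (\<lambda>w. w \<bullet> grad f (x + t *\<^sub>R d))) (at (x + t *\<^sub>R d))"
    using GDERIV_grad[OF assms] by (simp add: gderiv_def)
  have "((\<lambda>t. x + t *\<^sub>R d) has_derivative (\<lambda>u. u *\<^sub>R d)) (at t)"
    by (auto intro!: derivative_eq_intros)
  from has_derivative_compose[OF this, of f "\<lambda>w. w \<bullet> grad f (x + t *\<^sub>R d)"] f'
  show ?thesis
    by (simp add: has_field_derivative_def inner_commute mult_commute_abs)
qed

text \<open>Restriction to the line through \<open>x\<close> and \<open>y\<close> reduces this to
  the tangent inequality for convex functions of one real variable.\<close>

lemma convex_on_ge_grad:
  fixes f :: "'a::euclidean_space \<Rightarrow> real"
  assumes conv: "convex_on UNIV f" and diff: "f differentiable (at x)"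
  shows "f x + grad f x \<bullet> (y - x) \<le> f y"
proof -
  define h where "h t = f (x + t *\<^sub>R (y - x))" for t
  have "convex_on UNIV h"
  proof (rule convex_onI)
    fix t u v :: real
    assume "0 < t" "t < 1"
    then have "f ((1 - t) *\<^sub>R (x + u *\<^sub>R (y - x)) + t *\<^sub>R (x + v *\<^sub>R (y - x)))
        \<le> (1 - t) * h u + t * h v"
      unfolding h_def by (intro convex_onD[OF conv]) auto
    also have "(1 - t) *\<^sub>R (x + u *\<^sub>R (y - x)) + t *\<^sub>R (x + v *\<^sub>R (y - x))
        = x + ((1 - t) *\<^sub>R u + t *\<^sub>R v) *\<^sub>R (y - x)"
      by (simp add: algebra_simps)
    finally show "h ((1 - t) *\<^sub>R u + t *\<^sub>R v) \<le> (1 - t) * h u + t * h v"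
      by (simp add: h_def)
  qed simp
  moreover have "(h has_real_derivative (grad f x \<bullet> (y - x))) (at 0)"
    using has_real_derivative_along_line[of f x 0 "y - x"] diff by (simp add: h_def[abs_def])
  ultimately have "h 1 - h 0 \<ge> (grad f x \<bullet> (y - x)) * (1 - 0)"
    by (intro convex_on_imp_above_tangent[where A = UNIV]) auto
  then show ?thesis
    by (simp add: h_def)
qed

text \<open>Along the segment, \<open>f\<close> minus the claimed bound has nonpositive derivative,
  by Cauchy-Schwarz. The segment must stay where the gradient is Lipschitz, hence the convex set
  \<open>S\<close>.\<close>

lemma descent_inequality:
  fixes f :: "'a::euclidean_space \<Rightarrow> real"
  assumes diff: "\<And>z. f differentiable (at z)"
    and lip: "smoothness_parameter f S M"
    and S: "convex S" "x \<in> S" "y \<in> S"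
  shows "f y \<le> f x + grad f x \<bullet> (y - x) + M / 2 * (norm (y - x))\<^sup>2"
proof -
  define d where "d = y - x"
  define h where "h t = f (x + t *\<^sub>R d) - t * (grad f x \<bullet> d) - M / 2 * t\<^sup>2 * (norm d)\<^sup>2" for t
  have "h 1 \<le> h 0"
  proof (rule DERIV_nonpos_imp_nonincreasing[of 0 1 h])
    fix t :: real
    assume t: "0 \<le> t" "t \<le> 1"
    let ?z = "x + t *\<^sub>R d"
    have "((\<lambda>t. f (x + t *\<^sub>R d)) has_real_derivative (grad f ?z \<bullet> d)) (at t)"
      by (rule has_real_derivative_along_line[OF diff])
    then have D: "(h has_real_derivative
        (grad f ?z \<bullet> d - grad f x \<bullet> d - M * t * (norm d)\<^sup>2)) (at t)"
      unfolding h_def[abs_def] by (auto intro!: derivative_eq_intros)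
    have "?z = (1 - t) *\<^sub>R x + t *\<^sub>R y"
      by (simp add: d_def algebra_simps)
    then have "?z \<in> S"
      using convexD_alt[OF S t] by simp
    then have "norm (grad f ?z - grad f x) \<le> M * norm (?z - x)"
      using lip S unfolding smoothness_parameter_def by blast
    then have "norm (grad f ?z - grad f x) * norm d \<le> M * (t * norm d) * norm d"
      using t by (intro mult_right_mono) auto
    then have "(grad f ?z - grad f x) \<bullet> d \<le> M * t * (norm d)\<^sup>2"
      using norm_cauchy_schwarz[of "grad f ?z - grad f x" d] by (simp add: power2_eq_square)
    then show "\<exists>y. DERIV h t :> y \<and> y \<le> 0"
      using D by (intro exI[of _ "grad f ?z \<bullet> d - grad f x \<bullet> d - M * t * (norm d)\<^sup>2"])
        (simp add: inner_diff_left)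
  qed simp
  then show ?thesis
    by (simp add: h_def d_def)
qed

text \<open>The factor 3 leaves room for the gradient step from \<open>y\<close>, whose length is at most \<open>2 * \<rho>\<close>.\<close>

lemma cocoercive_on_cball:
  fixes f :: "'a::euclidean_space \<Rightarrow> real"
  assumes conv: "convex_on UNIV f"
    and diff: "\<And>z. f differentiable (at z)"
    and lip: "smoothness_parameter f (cball c (3 * \<rho>)) M"
    and x: "x \<in> cball c \<rho>" and y: "y \<in> cball c \<rho>"
  shows "f x + grad f x \<bullet> (y - x) + (norm (grad f y - grad f x))\<^sup>2 / (2 * M) \<le> f y"
proof -
  define w where "w = grad f y - grad f x"
  \<comment> \<open>This gradient step minimizes the quadratic model of \<open>f\<close> at
    \<open>y\<close> minus the tangent at \<open>x\<close>. The minimal value is nonnegative because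
    both bounds hold at \<open>z\<close>, and that is the claim.\<close>
  define z where "z = y - (1 / M) *\<^sub>R w"
  have M: "M > 0"
    using lip by (simp add: smoothness_parameter_def)
  have "\<rho> \<ge> 0"
    using x by (auto intro: order_trans[OF zero_le_dist])
  then have xy: "x \<in> cball c (3 * \<rho>)" "y \<in> cball c (3 * \<rho>)"
    using x y by auto
  then have "norm w \<le> M * norm (y - x)"
    using lip unfolding smoothness_parameter_def w_def by blast
  also have "norm (y - x) \<le> 2 * \<rho>"
    using x y dist_triangle2[of y x c] by (simp add: dist_norm[symmetric] dist_commute)
  finally have "norm w / M \<le> 2 * \<rho>"
    using M by (simp add: field_simps)
  then have "dist y z \<le> 2 * \<rho>"
    using M by (simp add: z_def dist_norm)
  then have z: "z \<in> cball c (3 * \<rho>)"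
    using y dist_triangle[of c z y] by simp
  have "f x + grad f x \<bullet> (z - x) \<le> f z"
    by (rule convex_on_ge_grad[OF conv diff])
  also have "f z \<le> f y + grad f y \<bullet> (z - y) + M / 2 * (norm (z - y))\<^sup>2"
    by (rule descent_inequality[OF diff lip _ xy(2) z]) simp
  finally have "f x + grad f x \<bullet> (z - x) \<le> f y + grad f y \<bullet> (z - y) + M / 2 * (norm (z - y))\<^sup>2" .
  moreover have "grad f x \<bullet> (z - x) = grad f x \<bullet> (y - x) - (grad f x \<bullet> w) / M"
    by (simp add: z_def inner_diff_right)
  moreover have "grad f y \<bullet> (z - y) = - (grad f y \<bullet> w) / M"
    by (simp add: z_def)
  moreover have "M / 2 * (norm (z - y))\<^sup>2 = (norm w)\<^sup>2 / (2 * M)"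
    using M by (simp add: z_def power_divide field_simps power2_eq_square)
  moreover have "(grad f y \<bullet> w) / M - (grad f x \<bullet> w) / M = 2 * ((norm w)\<^sup>2 / (2 * M))"
    using M by (simp add: w_def inner_diff_left diff_divide_distrib[symmetric] power2_norm_eq_inner
        field_simps)
  ultimately show ?thesis
    by (simp add: w_def[symmetric])
qed

lemma grad_eq_0_of_minimizer:
  fixes f :: "'a::euclidean_space \<Rightarrow> real"
  assumes "f differentiable (at c)" and "\<And>y. f c \<le> f y"
  shows "grad f c = 0"
proof -
  have "(f has_derivative (\<lambda>h. h \<bullet> grad f c)) (at c)"
    using GDERIV_grad[OF assms(1)] by (simp add: gderiv_def)
  then have "(\<lambda>h. h \<bullet> grad f c) = (\<lambda>h. 0)"
    using assms(2) by (intro differential_zero_maxmin[of c UNIV f]) auto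
  then have "grad f c \<bullet> grad f c = 0"
    by metis
  then show ?thesis
    by simp
qed

section \<open>The step-size rule and its quadratic form\<close>

text \<open>
  Here \<open>d\<close> is the denominator of the local curvature and \<open>G\<close> twice its numerator. The last hypothesis
  rules out \<open>d = 0 < G\<close>, where the curvature would be \<open>-\<infinity>\<close> in \<^typ>\<open>ereal\<close>.
\<close>

lemma step_size_bounds:
  fixes s' q c G d M :: real
  assumes s': "ereal s' = min (ereal q) (ereal c * (1 / - (ereal (1/2 * G) / ereal d)))"
    and "c > 0" "M > 0" "G \<ge> 0" "d \<le> - G / (2 * M)"
  shows "s' \<le> q" and "s' * G \<le> - 2 * c * d" and "min q (c / M) \<le> s'"
proof -
  have d: "d \<le> 0"
    using assms by (auto intro: order_trans)
  have "s' \<le> q \<and> s' * G \<le> - 2 * c * d \<and> min q (c / M) \<le> s'"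
  proof (cases "G = 0")
    case True
    \<comment> \<open>The convention 0/0 = 0 covers \<open>d = 0\<close> too: the curvature
      vanishes, its reciprocal is infinite, and \<open>q\<close> alone sets the step.\<close>
    then have "1 / - (ereal (1/2 * G) / ereal d) = \<infinity>"
      by (simp add: zero_ereal_def[symmetric] divide_ereal_def)
    with s' have "ereal s' = min (ereal q) (ereal c * \<infinity>)"
      by (simp only:)
    then have "s' = q"
      using \<open>c > 0\<close> by simp
    then show ?thesis
      using True \<open>c > 0\<close> d by (simp add: mult_nonneg_nonpos)
  next
    case False
    then have "- G / (2 * M) < 0"
      using assms by (simp add: divide_neg_pos)
    then have neg: "d < 0"
      using assms(5) by linarith
    have "- (ereal (1/2 * G) / ereal d) = ereal (- G / (2 * d))"
      using neg by simp
    then have "1 / - (ereal (1/2 * G) / ereal d) = ereal (- 2 * d / G)"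
      using neg False by (simp add: one_ereal_def field_simps)
    then have "ereal s' = ereal (min q (c * (- 2 * d / G)))"
      using s' by (simp add: min_def)
    then have eq: "s' = min q (c * (- 2 * d / G))"
      by (simp only: ereal.inject)
    have "G > 0"
      using False assms by simp
    then have "1 / M \<le> - 2 * d / G"
      using assms by (simp add: field_simps)
    then have "c * (1 / M) \<le> c * (- 2 * d / G)"
      using \<open>c > 0\<close> by (intro mult_left_mono) auto
    moreover have "s' * G \<le> c * (- 2 * d / G) * G"
      using eq \<open>G > 0\<close> by (intro mult_right_mono) auto
    ultimately show ?thesis
      using eq \<open>G > 0\<close> by auto
  qed
  then show "s' \<le> q" "s' * G \<le> - 2 * c * d" "min q (c / M) \<le> s'"
    by blast+
qed

text \<open>Completing the square in \<open>u - v\<close>.\<close>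

lemma step_quadratic_form:
  fixes u v :: "'a::real_inner" and a b b' s t :: real
  assumes "a > 0" "b > 0" "b' \<ge> 0" "s \<ge> 0" and b's: "b' * s \<le> a * t"
  shows "b' * s\<^sup>2 * (norm u)\<^sup>2 - 2 * s * a * t * (u \<bullet> v)
      - s\<^sup>2 * (a\<^sup>2 / b + b') * (norm (u - v))\<^sup>2 \<le> (b * t\<^sup>2 - a * s * t) * (norm v)\<^sup>2"
proof -
  define w where "w = u - v"
  define e where "e = b' * s - a * t"
  have u: "u = v + w"
    by (simp add: w_def)
  \<comment> \<open>After substituting \<open>u = v + w\<close> the terms in \<open>b'\<close> and
    \<open>norm w\<close> squared cancel. What remains in \<open>w\<close> is a concave quadratic
    with linear coefficient \<open>2 * s * e\<close>; this square bounds it by a multiple of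
    \<open>v \<bullet> v\<close>.\<close>
  have "0 \<le> b * (norm ((s * a / b) *\<^sub>R w - (e / a) *\<^sub>R v))\<^sup>2"
    using assms by simp
  also have "(norm (p *\<^sub>R w - q *\<^sub>R v))\<^sup>2 = p\<^sup>2 * (w \<bullet> w) - 2 * p * q * (w \<bullet> v) + q\<^sup>2 * (v \<bullet> v)"
    for p q
    unfolding power2_norm_eq_inner
    by (simp add: inner_diff_left inner_diff_right inner_commute[of v w] power2_eq_square algebra_simps)
  also have "b * ((s * a / b)\<^sup>2 * (w \<bullet> w) - 2 * (s * a / b) * (e / a) * (w \<bullet> v)
      + (e / a)\<^sup>2 * (v \<bullet> v)) = s\<^sup>2 * a\<^sup>2 / b * (w \<bullet> w) - 2 * s * e * (w \<bullet> v) + b * (e / a)\<^sup>2 * (v \<bullet> v)"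
    using assms by (simp add: power2_eq_square distrib_left right_diff_distrib mult_ac)
  finally have sq: "2 * s * e * (w \<bullet> v) - s\<^sup>2 * a\<^sup>2 / b * (w \<bullet> w) \<le> b * (e / a)\<^sup>2 * (v \<bullet> v)"
    by linarith
  have "b * (e / a)\<^sup>2 + b' * s\<^sup>2 - 2 * s * a * t
      = b * t\<^sup>2 - s * (2 * a * t - b' * s) * (1 + b * b' / a\<^sup>2)"
    using assms by (simp add: e_def field_simps power2_eq_square)
  \<comment> \<open>By \<open>b's\<close> the bracket is at least \<open>a * t\<close>, and the last
    factor is at least 1. What is left, \<open>- a * s * t\<close>, becomes dissipation.\<close>
  moreover have "s * (a * t) * 1 \<le> s * (2 * a * t - b' * s) * (1 + b * b' / a\<^sup>2)"
    using assms order_trans[OF mult_nonneg_nonneg[OF assms(3,4)] b's]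
    by (intro mult_mono mult_left_mono) (auto intro!: mult_nonneg_nonneg)
  ultimately have "b * (e / a)\<^sup>2 + b' * s\<^sup>2 - 2 * s * a * t \<le> b * t\<^sup>2 - a * s * t"
    by (simp add: algebra_simps)
  then have "(b * (e / a)\<^sup>2 + b' * s\<^sup>2 - 2 * s * a * t) * (v \<bullet> v) \<le> (b * t\<^sup>2 - a * s * t) * (v \<bullet> v)"
    by (intro mult_right_mono) auto
  moreover have "b' * s\<^sup>2 * (u \<bullet> u) - 2 * s * a * t * (u \<bullet> v) - s\<^sup>2 * (a\<^sup>2 / b + b') * (w \<bullet> w)
      = (b' * s\<^sup>2 - 2 * s * a * t) * (v \<bullet> v) + (2 * s * e * (w \<bullet> v) - s\<^sup>2 * a\<^sup>2 / b * (w \<bullet> w))"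
    unfolding u e_def
    by (simp add: inner_add_left inner_add_right inner_commute algebra_simps power2_eq_square)
  ultimately show ?thesis
    using sq by (simp add: power2_norm_eq_inner w_def[symmetric] algebra_simps)
qed

section \<open>Energy estimates for general parameter sequences\<close>

text \<open>\<open>A_B\<close> lets the first step bound supply the hypothesis of
  \<open>step_quadratic_form\<close>; \<open>A_Suc\<close>, \<open>r_le\<close> and
  \<open>s_0_ge\<close> keep the steps bounded below. The radius in \<open>lip\<close> is three
  times that of the ball holding the iterates, as \<open>cocoercive_on_cball\<close>
  requires.\<close>

locale adagd_run =
  fixes f :: "'a::euclidean_space \<Rightarrow> real"
    and xstar :: 'a and x :: "nat \<Rightarrow> 'a"
    and A B s :: "nat \<Rightarrow> real"
    and r Rbar M :: real
  assumes conv: "convex_on UNIV f"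
    and diff: "\<And>z. f differentiable (at z)"
    and minimizer: "\<And>z. f xstar \<le> f z"
    and A_pos: "\<And>k. A k > 0"
    and B_pos: "\<And>k. B k > 0"
    and A_B: "\<And>k. (prev A k + 1) * (B (Suc k) + 1) \<le> (A k)\<^sup>2"
    and A_Suc: "\<And>k. A (Suc k) \<le> A k + 1"
    and r_pos: "r > 0"
    and r_le: "\<And>k. r \<le> inverse (A k / B k + (B (Suc k) + 1) / A k)"
    and gen: "adagd A B f x s"
    and Rbar: "Rbar = (norm (x 0 - xstar))\<^sup>2 + (B 0 + 1) * (s 0)\<^sup>2 * (norm (grad f (x 0)))\<^sup>2"
    and lip: "smoothness_parameter f (cball xstar (3 * sqrt Rbar)) M"
    and s_0_ge: "r * A 0 / M \<le> s 0"
begin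

text \<open>Each term serves once: the distance, one index ahead, confines the next iterate; the
  second term gives the rate for \<open>f\<close>; the third completes the gradient sum.\<close>

definition energy :: "nat \<Rightarrow> real" where
  "energy k = (norm (x (Suc k) - xstar))\<^sup>2 + 2 * s k * (prev A k + 1) * (f (x k) - f xstar)
     + B k * (s k)\<^sup>2 * (norm (grad f (x k)))\<^sup>2"

text \<open>The first sum comes from cocoercivity with the minimizer, the second from the quadratic
  form. The term \<open>i = 0\<close> is the amount by which R lies below
  \<open>Rbar\<close>.\<close>

definition dissipation :: "nat \<Rightarrow> real" where
  "dissipation k = (\<Sum>i\<le>k. s i / M * (norm (grad f (x i)))\<^sup>2)
     + (\<Sum>j<k. A j * s (Suc j) * s j * (norm (grad f (x j)))\<^sup>2)"

lemma M_pos: "M > 0"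
  using lip by (simp add: smoothness_parameter_def)

lemma Rbar_nonneg: "Rbar \<ge> 0"
  using B_pos[of 0] by (simp add: Rbar)

lemma prev_A_nonneg: "prev A k \<ge> 0"
  using A_pos by (simp add: prev_def less_imp_le split: nat.split)

lemma x_Suc: "x (Suc k) = x k - s k *\<^sub>R grad f (x k)"
  using gen by (simp add: adagd_def)

lemma dist_step:
  assumes "x k \<in> cball xstar (sqrt Rbar)" and "s k > 0"
  shows "(norm (x (Suc k) - xstar))\<^sup>2 \<le> (norm (x k - xstar))\<^sup>2 - 2 * s k * (f (x k) - f xstar)
      + ((s k)\<^sup>2 - s k / M) * (norm (grad f (x k)))\<^sup>2"
proof -
  have "f (x k) + grad f (x k) \<bullet> (xstar - x k)
      + (norm (grad f xstar - grad f (x k)))\<^sup>2 / (2 * M) \<le> f xstar"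
    using Rbar_nonneg by (intro cocoercive_on_cball[OF conv diff lip assms(1)]) simp
  moreover have "grad f xstar = 0"
    by (rule grad_eq_0_of_minimizer[OF diff minimizer])
  ultimately have "2 * s k * (f (x k) - f xstar + (norm (grad f (x k)))\<^sup>2 / (2 * M))
      \<le> 2 * s k * (grad f (x k) \<bullet> (x k - xstar))"
    using assms(2) by (intro mult_left_mono) (auto simp: inner_diff_right)
  moreover have "(norm (x (Suc k) - xstar))\<^sup>2 = (norm (x k - xstar))\<^sup>2
      - 2 * s k * (grad f (x k) \<bullet> (x k - xstar)) + (s k)\<^sup>2 * (norm (grad f (x k)))\<^sup>2"
    unfolding x_Suc power2_norm_eq_inner
    by (simp add: inner_diff_left inner_diff_right inner_commute algebra_simps power2_eq_square)
  moreover have "2 * s k * (f (x k) - f xstar + (norm (grad f (x k)))\<^sup>2 / (2 * M))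
      = 2 * s k * (f (x k) - f xstar) + s k / M * (norm (grad f (x k)))\<^sup>2"
    using M_pos by (simp add: field_simps)
  ultimately show ?thesis
    by (simp add: left_diff_distrib)
qed

text \<open>Cocoercivity based at the new iterate says that the local curvature is at most
  \<open>M\<close>.\<close>

lemma step_bounds:
  assumes "x k \<in> cball xstar (sqrt Rbar)" "x (Suc k) \<in> cball xstar (sqrt Rbar)"
  defines "c \<equiv> inverse (A k / B k + (B (Suc k) + 1) / A k)"
    and "G \<equiv> (norm (grad f (x (Suc k)) - grad f (x k)))\<^sup>2"
    and "d \<equiv> f (x (Suc k)) - f (x k) + grad f (x (Suc k)) \<bullet> (x k - x (Suc k))"
  shows "s (Suc k) \<le> (prev A k + 1) / A k * s k"
    and "s (Suc k) * G \<le> - 2 * c * d"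
    and "min ((prev A k + 1) / A k * s k) (c / M) \<le> s (Suc k)"
proof -
  have s': "ereal (s (Suc k)) = min (ereal ((prev A k + 1) / A k * s k))
      (ereal c * (1 / - (ereal (1/2 * G) / ereal d)))"
    using gen by (simp add: adagd_def local_curvature_def c_def G_def d_def)
  have c: "c > 0"
    unfolding c_def using less_le_trans[OF r_pos r_le] .
  have "f (x (Suc k)) + grad f (x (Suc k)) \<bullet> (x k - x (Suc k))
      + (norm (grad f (x k) - grad f (x (Suc k))))\<^sup>2 / (2 * M) \<le> f (x k)"
    by (rule cocoercive_on_cball[OF conv diff lip assms(2,1)])
  then have d: "d \<le> - G / (2 * M)"
    by (simp add: d_def G_def norm_minus_commute)
  note b = step_size_bounds[OF s' c M_pos _ d]
  show "s (Suc k) \<le> (prev A k + 1) / A k * s k" "s (Suc k) * G \<le> - 2 * c * d"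
    "min ((prev A k + 1) / A k * s k) (c / M) \<le> s (Suc k)"
    by (rule b; simp add: G_def)+
qed

lemma energy_step:
  assumes x: "x k \<in> cball xstar (sqrt Rbar)" "x (Suc k) \<in> cball xstar (sqrt Rbar)"
    and s: "s k > 0" "s (Suc k) > 0"
  shows "energy (Suc k) + s (Suc k) / M * (norm (grad f (x (Suc k))))\<^sup>2
      + A k * s (Suc k) * s k * (norm (grad f (x k)))\<^sup>2 \<le> energy k"
proof -
  define u v where "u = grad f (x (Suc k))" and "v = grad f (x k)"
  \<comment> \<open>The extra 1 in \<open>b'\<close> absorbs the squared step length that
    \<open>dist_step\<close> contributes at \<open>Suc k\<close>.\<close>
  define a b b' where "a = A k" and "b = B k" and "b' = B (Suc k) + 1"
  define t t' where "t = s k" and "t' = s (Suc k)"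
  define d where "d = f (x (Suc k)) - f (x k) + grad f (x (Suc k)) \<bullet> (x k - x (Suc k))"
  note defs = u_def v_def a_def b_def b'_def t_def t'_def d_def
  have pos: "a > 0" "b > 0" "b' > 0" "t > 0" "t' > 0"
    using A_pos B_pos s B_pos[of "Suc k"] by (auto simp: defs intro: add_pos_pos)
  note bounds = step_bounds[OF x, folded defs]
  have at': "a * t' \<le> (prev A k + 1) * t"
    using bounds(1) pos by (simp add: field_simps)
  have "b' * (a * t') \<le> b' * ((prev A k + 1) * t)"
    using at' pos by (intro mult_left_mono) auto
  also have "\<dots> \<le> a\<^sup>2 * t"
    using mult_right_mono[OF A_B[of k], of t] pos by (simp add: defs algebra_simps)
  finally have "a * (b' * t') \<le> a * (a * t)"
    by (simp add: power2_eq_square algebra_simps)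
  then have b't': "b' * t' \<le> a * t"
    using pos by simp
  have quad: "b' * t'\<^sup>2 * (norm u)\<^sup>2 - 2 * t' * a * t * (u \<bullet> v)
      - t'\<^sup>2 * (a\<^sup>2 / b + b') * (norm (u - v))\<^sup>2 \<le> (b * t\<^sup>2 - a * t' * t) * (norm v)\<^sup>2"
    using pos b't' by (intro step_quadratic_form) auto
  have c: "a / b + b' / a > 0"
    using pos by (simp add: add_pos_pos)
  then have "(a / b + b' / a) * (t' * (norm (u - v))\<^sup>2) \<le> - 2 * d"
    using bounds(2) by (simp add: field_simps)
  then have "(t' * a) * ((a / b + b' / a) * (t' * (norm (u - v))\<^sup>2)) \<le> (t' * a) * (- 2 * d)"
    using pos by (intro mult_left_mono) auto
  moreover have "(t' * a) * ((a / b + b' / a) * (t' * (norm (u - v))\<^sup>2))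
      = t'\<^sup>2 * (a\<^sup>2 / b + b') * (norm (u - v))\<^sup>2"
    using pos by (simp add: field_simps power2_eq_square)
  ultimately have curv: "t'\<^sup>2 * (a\<^sup>2 / b + b') * (norm (u - v))\<^sup>2 \<le> - 2 * t' * a * d"
    by simp
  \<comment> \<open>Since \<open>x k - x (Suc k)\<close> equals \<open>t *\<^sub>R v\<close>, the
    curvature denominator produces exactly the mixed term \<open>u \<bullet> v\<close> of
    \<open>quad\<close>, and trades the function value at \<open>Suc k\<close> for the one at
    \<open>k\<close>.\<close>
  have "d = f (x (Suc k)) - f (x k) + t * (u \<bullet> v)"
    by (simp add: d_def u_def x_Suc[of k] t_def v_def)
  then have "- 2 * t' * a * d
      = 2 * t' * a * (f (x k) - f (x (Suc k))) - 2 * t' * a * t * (u \<bullet> v)"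
    by (simp only:) (simp add: algebra_simps)
  moreover have "a * t' * (f (x k) - f xstar) \<le> (prev A k + 1) * t * (f (x k) - f xstar)"
    using at' minimizer by (intro mult_right_mono) auto
  moreover note dist_step[OF x(2) s(2)]
  moreover have "prev A (Suc k) = a"
    by (simp add: prev_def a_def)
  ultimately show ?thesis
    using quad curv by (simp add: energy_def defs algebra_simps)
qed

text \<open>The claims need a joint induction: the step bounds require both iterates in the ball,
  and the energy that confines them requires positive steps. The second conjunct keeps the first
  entry of the minimum at least \<open>r / M\<close>.\<close>

lemma invariant:
  "0 < s k \<and> r * A k / M \<le> (prev A k + 1) * s k \<and> x k \<in> cball xstar (sqrt Rbar)
    \<and> 0 \<le> dissipation k \<and> energy k + dissipation k \<le> Rbar \<and> (k > 0 \<longrightarrow> r / M \<le> s k)"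
proof (induction k)
  case 0
  have s: "s 0 > 0"
    using gen by (simp add: adagd_def)
  have "(norm (x 0 - xstar))\<^sup>2 \<le> Rbar"
    using B_pos[of 0] by (simp add: Rbar)
  then have x: "x 0 \<in> cball xstar (sqrt Rbar)"
    by (simp add: dist_norm norm_minus_commute real_le_rsqrt)
  \<comment> \<open>The coefficient \<open>B 0 + 1\<close> in \<open>Rbar\<close> is
    \<open>B 0\<close> from \<open>energy\<close> plus 1 from \<open>dist_step\<close>.\<close>
  have "energy 0 + dissipation 0 \<le> Rbar"
    using dist_step[OF x s] by (simp add: energy_def dissipation_def Rbar prev_def algebra_simps)
  then show ?case
    using s s_0_ge x M_pos by (simp add: prev_def dissipation_def)
next
  case (Suc k)
  then have s: "s k > 0" and x: "x k \<in> cball xstar (sqrt Rbar)"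
    and E: "energy k + dissipation k \<le> Rbar" and rA: "r * A k / M \<le> (prev A k + 1) * s k"
    by auto
  have diss: "0 \<le> dissipation k"
    using Suc.IH by blast
  \<comment> \<open>The next iterate is confined before its own step size is examined.\<close>
  moreover have "(norm (x (Suc k) - xstar))\<^sup>2 \<le> energy k"
    using B_pos[of k] s prev_A_nonneg[of k] minimizer[of "x k"] by (simp add: energy_def)
  ultimately have "(norm (x (Suc k) - xstar))\<^sup>2 \<le> Rbar"
    using E by linarith
  then have x': "x (Suc k) \<in> cball xstar (sqrt Rbar)"
    by (simp add: dist_norm norm_minus_commute real_le_rsqrt)
  have "r / M \<le> (prev A k + 1) / A k * s k"
    using rA A_pos[of k] by (simp add: field_simps)
  moreover have "r / M \<le> inverse (A k / B k + (B (Suc k) + 1) / A k) / M"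
    using r_le[of k] M_pos by (intro divide_right_mono) auto
  ultimately have s'_ge: "r / M \<le> s (Suc k)"
    using step_bounds(3)[OF x x'] by linarith
  moreover have "r / M > 0"
    using r_pos M_pos by simp
  ultimately have s': "s (Suc k) > 0"
    by linarith
  have "A (Suc k) * (r / M) \<le> (prev A (Suc k) + 1) * s (Suc k)"
    using A_Suc[of k] A_pos[of k] s'_ge s' \<open>r / M > 0\<close>
    by (intro mult_mono) (auto simp: prev_def)
  moreover have "energy (Suc k) + dissipation (Suc k) \<le> Rbar"
    using energy_step[OF x x' s s'] E by (simp add: dissipation_def)
  moreover have "dissipation (Suc k) = dissipation k
      + s (Suc k) / M * (norm (grad f (x (Suc k))))\<^sup>2
      + A k * s (Suc k) * s k * (norm (grad f (x k)))\<^sup>2"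
    by (simp add: dissipation_def)
  then have "0 \<le> dissipation (Suc k)"
    using diss s s' M_pos A_pos[of k] by simp
  ultimately show ?case
    using s' s'_ge x' by (simp add: mult.commute)
qed

lemma s_pos: "s k > 0"
  using invariant by blast

lemma s_ge: "k > 0 \<Longrightarrow> r / M \<le> s k"
  using invariant by blast

lemma dissipation_ge: "s 0 / M * (norm (grad f (x 0)))\<^sup>2 \<le> dissipation k"
proof -
  have "s 0 / M * (norm (grad f (x 0)))\<^sup>2 = (\<Sum>i\<in>{0}. s i / M * (norm (grad f (x i)))\<^sup>2)"
    by simp
  also have "\<dots> \<le> (\<Sum>i\<le>k. s i / M * (norm (grad f (x i)))\<^sup>2)"
    using s_pos M_pos by (intro sum_mono2) (auto simp: less_imp_le)
  also have "\<dots> \<le> dissipation k"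
    using s_pos A_pos by (simp add: dissipation_def sum_nonneg less_imp_le)
  finally show ?thesis .
qed

lemma function_value_bound:
  "f (x k) - f xstar \<le> M / (2 * r) * (1 / A k) * (Rbar - s 0 / M * (norm (grad f (x 0)))\<^sup>2)"
proof -
  have "0 \<le> B k * (s k)\<^sup>2 * (norm (grad f (x k)))\<^sup>2"
    using B_pos[of k] by simp
  moreover have "2 * (r * A k / M) * (f (x k) - f xstar)
      \<le> 2 * ((prev A k + 1) * s k) * (f (x k) - f xstar)"
    using invariant[of k] minimizer[of "x k"] by (intro mult_right_mono mult_left_mono) auto
  moreover have "2 * ((prev A k + 1) * s k) * (f (x k) - f xstar)
      = 2 * s k * (prev A k + 1) * (f (x k) - f xstar)"
    by simp
  ultimately have "2 * (r * A k / M) * (f (x k) - f xstar) \<le> energy k"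
    using zero_le_power2[of "norm (x (Suc k) - xstar)"] unfolding energy_def by linarith
  also have "\<dots> \<le> Rbar - s 0 / M * (norm (grad f (x 0)))\<^sup>2"
    using invariant[of k] dissipation_ge[of k] by linarith
  finally show ?thesis
    using r_pos M_pos A_pos[of k] by (simp add: field_simps)
qed

text \<open>Every gradient with index in \<open>{1..k}\<close> is replaced by the smallest one.
  Lowering the weights \<open>A j\<close> to \<open>B j\<close> lets the energy term of index
  \<open>k\<close> extend the sum.\<close>

lemma min_grad_bound:
  assumes "k \<ge> 1" and B_le_A: "\<And>j. B j \<le> A j"
  shows "Min ((\<lambda>i. (norm (grad f (x i)))\<^sup>2) ` {1..k}) * (k * r / M\<^sup>2 + (r / M)\<^sup>2 * sum B {1..k})
    \<le> Rbar - s 0 / M * (norm (grad f (x 0)))\<^sup>2"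
proof -
  define G where "G i = (norm (grad f (x i)))\<^sup>2" for i
  define m where "m = Min (G ` {1..k})"
  have m: "m \<le> G i" if "i \<in> {1..k}" for i
    using that by (simp add: m_def)
  have "m \<in> G ` {1..k}"
    using \<open>k \<ge> 1\<close> unfolding m_def by (intro Min_in) auto
  then have m0: "m \<ge> 0"
    by (auto simp: G_def)
  have rM: "r / M > 0"
    using r_pos M_pos by simp
  have weight: "w' * m \<le> w * G i" if "w' \<le> w" "0 \<le> w'" "i \<in> {1..k}" for w w' i
    using that m[of i] m0 by (intro mult_mono) auto
  have "k * r / M\<^sup>2 * m = (\<Sum>i\<in>{1..k}. r / M / M * m)"
    by (simp add: power2_eq_square)
  also have "\<dots> \<le> (\<Sum>i\<in>{1..k}. s i / M * G i)"
    using M_pos r_pos by (intro sum_mono weight divide_right_mono s_ge) auto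
  also have "\<dots> = (\<Sum>i\<le>k. s i / M * G i) - s 0 / M * G 0"
    by (simp add: atMost_atLeast0 sum.atLeast_Suc_atMost)
  finally have sum1: "k * r / M\<^sup>2 * m \<le> (\<Sum>i\<le>k. s i / M * G i) - s 0 / M * G 0" .
  have "(r / M)\<^sup>2 * sum B {1..<k} * m = (\<Sum>j\<in>{1..<k}. B j * (r / M) * (r / M) * m)"
    by (simp add: sum_distrib_left sum_distrib_right sum_divide_distrib power2_eq_square
        mult_ac)
  also have "\<dots> \<le> (\<Sum>j\<in>{1..<k}. A j * s (Suc j) * s j * G j)"
    using s_ge rM B_le_A A_pos B_pos s_pos r_pos
    by (intro sum_mono weight mult_mono)
      (auto simp: less_imp_le intro!: divide_nonneg_nonneg mult_nonneg_nonneg)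
  also have "\<dots> \<le> (\<Sum>j<k. A j * s (Suc j) * s j * G j)"
    using s_pos A_pos by (intro sum_mono2) (auto simp: less_imp_le G_def)
  finally have sum2: "(r / M)\<^sup>2 * sum B {1..<k} * m \<le> (\<Sum>j<k. A j * s (Suc j) * s j * G j)" .
  \<comment> \<open>The second sum in \<open>dissipation k\<close> stops at \<open>k - 1\<close>;
    the missing index is supplied by \<open>energy k\<close>.\<close>
  have last: "B k * (r / M)\<^sup>2 * m \<le> B k * (s k)\<^sup>2 * G k"
    using s_ge[of k] rM B_pos[of k] \<open>k \<ge> 1\<close> by (intro weight mult_left_mono power_mono) auto
  have "B k * (s k)\<^sup>2 * G k \<le> energy k"
    using s_pos[of k] prev_A_nonneg[of k] minimizer[of "x k"] by (simp add: energy_def G_def)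
  moreover have "sum B {1..k} = sum B {1..<k} + B k"
    using \<open>k \<ge> 1\<close> by (metis atLeastLessThanSuc_atLeastAtMost sum.atLeastLessThan_Suc)
  moreover have "energy k + dissipation k \<le> Rbar"
    using invariant by blast
  ultimately have "m * (k * r / M\<^sup>2 + (r / M)\<^sup>2 * sum B {1..k}) \<le> Rbar - s 0 / M * G 0"
    using sum1 sum2 last by (simp add: dissipation_def G_def algebra_simps)
  then show ?thesis
    by (simp add: m_def G_def)
qed

end

section \<open>The linear parameter sequences and the resulting rates\<close>

theorem corollary4:
  fixes f :: "real ^ 'd \<Rightarrow> real"
    and xstar x0 xtilde0 :: "real ^ 'd"
    and x :: "nat \<Rightarrow> real ^ 'd"
    and s A B :: "nat \<Rightarrow> real"
    and \<gamma> r L0 Rbar L :: real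
    and R :: "real \<Rightarrow> real"
    and K :: "(real ^ 'd) set"
  assumes smooth: "locally_smooth f"
    and convex: "convex_on UNIV f"
    and minimizer: "\<forall>y. f xstar \<le> f y"
    and gamma: "0 < \<gamma>" "\<gamma> \<le> 1"
    and A: "\<forall>k. A k = \<gamma> * real (k + 1) + 2"
    and B: "\<forall>k. B k = \<gamma> * real (k + 1)"
    and r: "r = inverse (A 0 / B 0 + (B 1 + 1) / A 0)"
    and x0_neq: "x0 \<noteq> xtilde0"
    and L0: "L0 = norm (grad f x0 - grad f xtilde0) / norm (x0 - xtilde0)"
    and L0_pos: "L0 > 0"
    and x_0: "x 0 = x0"
    and s_0: "s 0 = r * A 0 * (1 / L0)"
    and gen: "adagd A B f x s"
    and Rbar: "Rbar = (norm (x0 - xstar))\<^sup>2 + (B 0 + 1) * (s 0)\<^sup>2 * (norm (grad f x0))\<^sup>2"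
    and K: "K = cball xstar (3 * sqrt Rbar) \<union> cball xstar (3 * norm (xtilde0 - xstar))"
    and L: "smoothness_parameter f K L"
    and R: "\<forall>M. R M = Rbar - s 0 / M * (norm (grad f x0))\<^sup>2"
  shows "(r = \<gamma> * (\<gamma> + 2) / (3 * \<gamma>\<^sup>2 + 5 * \<gamma> + 4) \<and> r \<le> 1) \<and>
    (\<forall>k. f (x k) - f xstar \<le> L / (2 * r) * (1 / (\<gamma> * real (k + 1) + 2)) * R L) \<and>
    (\<lambda>(M, k). M / (2 * r) * (1 / (\<gamma> * real (k + 1) + 2)) * R M)
      \<in> O[principal {M. smoothness_parameter f K M} \<times>\<^sub>F sequentially](\<lambda>(M, k). M / real k) \<and>
    (\<forall>k\<ge>1. Min ((\<lambda>i. (norm (grad f (x i)))\<^sup>2) ` {1..k})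
      \<le> 2 * L\<^sup>2 / r * (1 / (real k * (r * \<gamma> * real (k + 3) + 2))) * R L) \<and>
    (\<lambda>(M, k). 2 * M\<^sup>2 / r * (1 / (real k * (r * \<gamma> * real (k + 3) + 2))) * R M)
      \<in> O[principal {M. smoothness_parameter f K M} \<times>\<^sub>F sequentially](\<lambda>(M, k). M\<^sup>2 / (real k)\<^sup>2)"
proof -
  note A' = A[rule_format] and B' = B[rule_format]
  have den: "A 0 / B 0 + (B 1 + 1) / A 0 = (3 * \<gamma>\<^sup>2 + 5 * \<gamma> + 4) / (\<gamma> * (\<gamma> + 2))"
    using gamma by (simp add: A' B' field_simps power2_eq_square)
  have r_eq: "r = \<gamma> * (\<gamma> + 2) / (3 * \<gamma>\<^sup>2 + 5 * \<gamma> + 4)"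
    unfolding r den by simp
  have "\<gamma> * (\<gamma> + 2) \<le> 3 * \<gamma>\<^sup>2 + 5 * \<gamma> + 4" and "0 < 3 * \<gamma>\<^sup>2 + 5 * \<gamma> + 4"
    using gamma zero_le_power2[of \<gamma>] by (auto simp: power2_eq_square distrib_left intro!: add_pos_pos)
  then have r_le_1: "r \<le> 1" and r_pos: "r > 0"
    using gamma by (simp_all add: r_eq)
  \<comment> \<open>The smoothness parameter stays arbitrary because the O-estimates let it
    vary.\<close>
  have run: "adagd_run f xstar x A B s r Rbar M" if M: "smoothness_parameter f K M" for M
  proof
    show "convex_on UNIV f"
      by (rule convex)
    show "f differentiable (at z)" for z
      using smooth by (simp add: locally_smooth_def)
    show "f xstar \<le> f z" for z
      using minimizer by blast
    show "A k > 0" "B k > 0" "A (Suc k) \<le> A k + 1" for k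
      using gamma by (auto simp: A' B' algebra_simps intro!: add_nonneg_pos add_pos_nonneg)
    show "(prev A k + 1) * (B (Suc k) + 1) \<le> (A k)\<^sup>2" for k
    proof (cases k)
      case 0
      then show ?thesis
        using gamma by (simp add: prev_def A' B' power2_eq_square algebra_simps)
    next
      case (Suc j)
      \<comment> \<open>The two factors lie symmetrically about \<open>A k = y + 2\<close>, so their
        product is a difference of squares.\<close>
      define y where "y = \<gamma> * real (Suc k)"
      have "(prev A k + 1) * (B (Suc k) + 1) = (y + 2 + (1 - \<gamma>)) * (y + 2 - (1 - \<gamma>))"
        by (simp add: Suc prev_def A' B' y_def algebra_simps)
      also have "\<dots> = (y + 2)\<^sup>2 - (1 - \<gamma>)\<^sup>2"
        by (simp add: power2_eq_square algebra_simps)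
      also have "\<dots> \<le> (A k)\<^sup>2"
        by (simp add: A' y_def)
      finally show ?thesis .
    qed
    show "r > 0"
      by (rule r_pos)
    show "r \<le> inverse (A k / B k + (B (Suc k) + 1) / A k)" for k
    proof -
      \<comment> \<open>The inverted sum is largest at \<open>k = 0\<close>, where
        \<open>y = \<gamma>\<close>: as \<open>y\<close> grows, the drop in \<open>2 / y\<close>
        outweighs the change in \<open>(1 - \<gamma>) / (y + 2)\<close>.\<close>
      define y where "y = \<gamma> * real (Suc k)"
      have "\<gamma> * 1 \<le> y"
        unfolding y_def using gamma by (intro mult_left_mono) auto
      then have y: "\<gamma> \<le> y" "0 < y"
        using gamma by auto
      have split: "(z + 2) / z + (z + \<gamma> + 1) / (z + 2) = 2 + 2 / z - (1 - \<gamma>) / (z + 2)"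
        if "z > 0" for z
        using that by (simp add: field_simps)
      have "(1 - \<gamma>) / (\<gamma> + 2) - (1 - \<gamma>) / (y + 2) = (1 - \<gamma>) * (y - \<gamma>) / ((\<gamma> + 2) * (y + 2))"
        using gamma y by (simp add: field_simps)
      also have "\<dots> \<le> 2 * (y - \<gamma>) / (\<gamma> * y)"
        using gamma y by (intro frac_le mult_mono mult_right_mono mult_pos_pos mult_nonneg_nonneg) auto
      also have "\<dots> = 2 / \<gamma> - 2 / y"
        using gamma y by (simp add: field_simps)
      finally have "(y + 2) / y + (y + \<gamma> + 1) / (y + 2) \<le> (\<gamma> + 2) / \<gamma> + (\<gamma> + \<gamma> + 1) / (\<gamma> + 2)"
        unfolding split[OF y(2)] split[OF gamma(1)] by linarith
      moreover have "A k = y + 2" "B k = y" "B (Suc k) + 1 = y + \<gamma> + 1"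
        "A 0 = \<gamma> + 2" "B 0 = \<gamma>" "B 1 + 1 = \<gamma> + \<gamma> + 1"
        by (simp_all add: A' B' y_def algebra_simps)
      ultimately show ?thesis
        unfolding r using gamma y by (intro le_imp_inverse_le) (auto intro: add_pos_pos)
    qed
    show "adagd A B f x s"
      by (rule gen)
    show "Rbar = (norm (x 0 - xstar))\<^sup>2 + (B 0 + 1) * (s 0)\<^sup>2 * (norm (grad f (x 0)))\<^sup>2"
      using Rbar x_0 by simp
    show "smoothness_parameter f (cball xstar (3 * sqrt Rbar)) M"
      using M by (auto simp: smoothness_parameter_def K)
    have "M > 0"
      using M by (simp add: smoothness_parameter_def)
    have "B 0 > 0"
      using gamma by (simp add: B')
    then have "(norm (x0 - xstar))\<^sup>2 \<le> Rbar"
      by (simp add: Rbar)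
    then have "norm (x0 - xstar) \<le> sqrt Rbar"
      by (simp add: real_le_rsqrt)
    then have "norm (x0 - xstar) \<le> 3 * sqrt Rbar"
      using norm_ge_zero[of "x0 - xstar"] by linarith
    \<comment> \<open>The second ball in \<open>K\<close> is there to contain
      \<open>xtilde0\<close>; this gives \<open>L0 \<le> M\<close> and hence the lower bound on
      \<open>s 0\<close>.\<close>
    then have "x0 \<in> K" "xtilde0 \<in> K"
      using norm_ge_zero[of "xtilde0 - xstar"]
      by (auto simp: K dist_norm norm_minus_commute simp del: norm_ge_zero)
    then have "norm (grad f x0 - grad f xtilde0) \<le> M * norm (x0 - xtilde0)"
      using M unfolding smoothness_parameter_def by blast
    then have "L0 \<le> M"
      using x0_neq by (simp add: L0 divide_le_eq)
    then show "r * A 0 / M \<le> s 0"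
      using L0_pos r_pos \<open>M > 0\<close> gamma by (auto simp: s_0 A' intro!: divide_left_mono)
  qed

  have R_bounds: "0 \<le> R M" "R M \<le> Rbar" "M > 0" if M: "smoothness_parameter f K M" for M
  proof -
    interpret adagd_run f xstar x A B s r Rbar M
      by (rule run[OF M])
    show "M > 0"
      by (rule M_pos)
    show "R M \<le> Rbar"
      using s_pos[of 0] M_pos by (simp add: R)
    \<comment> \<open>Nonnegativity of \<open>R M\<close> is read off the function bound at index 0,
      whose left side is nonnegative.\<close>
    have "0 \<le> M / (2 * r) * (1 / A 0) * R M"
      using function_value_bound[of 0] minimizer[rule_format, of "x 0"] x_0 by (simp add: R)
    moreover have "0 < M / (2 * r) * (1 / A 0)"
      using M_pos r_pos A_pos[of 0] by simp
    ultimately show "0 \<le> R M"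
      unfolding zero_le_mult_iff by linarith
  qed
  have ev: "\<forall>\<^sub>F p in principal {M. smoothness_parameter f K M} \<times>\<^sub>F sequentially.
      smoothness_parameter f K (fst p) \<and> snd p > 0"
    using eventually_prodI[of "smoothness_parameter f K" "principal {M. smoothness_parameter f K M}"
        "\<lambda>k. k > 0" sequentially]
    by (simp add: eventually_principal eventually_gt_at_top)

  interpret adagd_run f xstar x A B s r Rbar L
    by (rule run[OF L])
  have "f (x k) - f xstar \<le> L / (2 * r) * (1 / (\<gamma> * real (k + 1) + 2)) * R L" for k
    using function_value_bound[of k] by (simp add: R x_0 A')
  moreover have "(\<lambda>(M, k). M / (2 * r) * (1 / (\<gamma> * real (k + 1) + 2)) * R M)
      \<in> O[principal {M. smoothness_parameter f K M} \<times>\<^sub>F sequentially](\<lambda>(M, k). M / real k)"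
  proof (rule bigoI[where c = "Rbar / (2 * r * \<gamma>)"], rule eventually_mono[OF ev])
    fix p :: "real \<times> nat"
    assume "smoothness_parameter f K (fst p) \<and> snd p > 0"
    then obtain M k where p: "p = (M, k)" and M: "smoothness_parameter f K M" and k: "k > 0"
      by (cases p) auto
    note b = R_bounds[OF M]
    let ?e = "M / (2 * r) * (1 / (\<gamma> * real (k + 1) + 2)) * R M"
    have pos: "\<gamma> * real (k + 1) + 2 > 0"
      using r_pos gamma by (intro add_nonneg_pos) auto
    have "0 \<le> ?e"
      using b k r_pos pos by (intro mult_nonneg_nonneg) auto
    \<comment> \<open>Dropping the constants from the denominator and using
      \<open>R M \<le> Rbar\<close> leaves a constant independent of \<open>M\<close>.\<close>
    moreover have "?e \<le> M / (2 * r) * (1 / (\<gamma> * real k)) * Rbar"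
      using b k r_pos gamma pos
      by (intro mult_mono divide_left_mono mult_pos_pos mult_nonneg_nonneg) (auto simp: algebra_simps)
    moreover have "\<dots> = (Rbar / (2 * r * \<gamma>)) * (M / real k)"
      using r_pos gamma k by (simp add: field_simps power2_eq_square)
    ultimately show "norm (case p of (M, k) \<Rightarrow> M / (2 * r) * (1 / (\<gamma> * real (k + 1) + 2)) * R M)
        \<le> (Rbar / (2 * r * \<gamma>)) * norm (case p of (M, k) \<Rightarrow> M / real k)"
      using b(3) by (simp only: p prod.case real_norm_def abs_of_nonneg) simp
  qed
  moreover have "Min ((\<lambda>i. (norm (grad f (x i)))\<^sup>2) ` {1..k})
      \<le> 2 * L\<^sup>2 / r * (1 / (real k * (r * \<gamma> * real (k + 3) + 2))) * R L" if k: "k \<ge> 1" for k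
  proof -
    \<comment> \<open>This arithmetic sum is the source of \<open>k + 3\<close> in the rate.\<close>
    have "sum B {1..k} = \<gamma> * (real k * real (k + 3) / 2)"
      by (induction k) (simp_all add: B' algebra_simps)
    then have weight: "k * r / L\<^sup>2 + (r / L)\<^sup>2 * sum B {1..k}
        = r / (2 * L\<^sup>2) * (real k * (r * \<gamma> * real (k + 3) + 2))"
      using M_pos by (simp add: field_simps power2_eq_square)
    have "B j \<le> A j" for j
      by (simp add: A' B')
    from min_grad_bound[OF k this]
    have "Min ((\<lambda>i. (norm (grad f (x i)))\<^sup>2) ` {1..k})
        * (r / (2 * L\<^sup>2) * (real k * (r * \<gamma> * real (k + 3) + 2))) \<le> R L"
      unfolding weight by (simp add: R x_0)
    moreover have "0 < r / (2 * L\<^sup>2) * (real k * (r * \<gamma> * real (k + 3) + 2))"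
      using k r_pos M_pos gamma by (intro mult_pos_pos add_nonneg_pos) auto
    ultimately have "Min ((\<lambda>i. (norm (grad f (x i)))\<^sup>2) ` {1..k})
        \<le> R L / (r / (2 * L\<^sup>2) * (real k * (r * \<gamma> * real (k + 3) + 2)))"
      by (simp only: pos_le_divide_eq)
    then show ?thesis
      by (simp add: mult_ac)
  qed
  moreover have "(\<lambda>(M, k). 2 * M\<^sup>2 / r * (1 / (real k * (r * \<gamma> * real (k + 3) + 2))) * R M)
      \<in> O[principal {M. smoothness_parameter f K M} \<times>\<^sub>F sequentially](\<lambda>(M, k). M\<^sup>2 / (real k)\<^sup>2)"
  proof (rule bigoI[where c = "2 * Rbar / (r\<^sup>2 * \<gamma>)"], rule eventually_mono[OF ev])
    fix p :: "real \<times> nat"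
    assume "smoothness_parameter f K (fst p) \<and> snd p > 0"
    then obtain M k where p: "p = (M, k)" and M: "smoothness_parameter f K M" and k: "k > 0"
      by (cases p) auto
    note b = R_bounds[OF M]
    let ?e = "2 * M\<^sup>2 / r * (1 / (real k * (r * \<gamma> * real (k + 3) + 2))) * R M"
    have pos: "r * \<gamma> * real (k + 3) + 2 > 0"
      using r_pos gamma by (intro add_nonneg_pos) auto
    have "0 \<le> ?e"
      using b k r_pos pos by (intro mult_nonneg_nonneg) auto
    moreover have "?e \<le> 2 * M\<^sup>2 / r * (1 / (real k * (r * \<gamma> * real k))) * Rbar"
      using b k r_pos gamma pos
      by (intro mult_mono divide_left_mono mult_pos_pos mult_nonneg_nonneg) (auto simp: algebra_simps)
    moreover have "\<dots> = (2 * Rbar / (r\<^sup>2 * \<gamma>)) * (M\<^sup>2 / (real k)\<^sup>2)"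
      using r_pos gamma k by (simp add: field_simps power2_eq_square)
    ultimately show "norm (case p of (M, k) \<Rightarrow> 2 * M\<^sup>2 / r * (1 / (real k * (r * \<gamma> * real (k + 3) + 2))) * R M)
        \<le> (2 * Rbar / (r\<^sup>2 * \<gamma>)) * norm (case p of (M, k) \<Rightarrow> M\<^sup>2 / (real k)\<^sup>2)"
      using b(3) by (simp only: p prod.case real_norm_def abs_of_nonneg) simp
  qed
  ultimately show ?thesis
    using r_eq r_le_1 by blast
qed

end
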